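(* Let $V$ be a finite set of variants partitioned into semantic classes $\mathcal{C}$, let $m:V\to[0,1]$ be a score function, let $\hat h:\mathcal{C}\to\{0,1\}$ be the audited class label map, let $h^\star:V\to\{0,1\}$ be the latent variant-level harm, and let $\mathcal{X}=\Delta(V)$ be the set of platform strategies. Let $$\hat\alpha=\min_{c\in\mathcal{C}:\,\hat h(c)=1}\ \max_{u:\mathrm{cl}(u)=c} m(u),$$ where at least one class $c$ has $\hat h(c)=1$, and suppose $\hat\alpha>0$. Let $\bar\eta$ be a real number such that the disagreement mass satisfies $\Delta(x)\le\bar\eta$ for all strategies $x\in\mathcal{X}$. Then for every $x\in\mathcal{X}$, $$\mathsf{H}^\star(x)\le \frac{1}{\hat\alpha}\,\mathsf{M}_{\mathrm{Env}(m)}(x)+\bar\eta.$$ Thus the semantic-envelope metric $\mathsf{M}_{\mathrm{Env}(m)}$ is $(1/\hat\alpha,\bar\eta)$-certifying with respect to latent harm.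
   Context: Variants and classes. $V$ is a finite set of content variants. A published audit protocol consists of a finite relation $T_0\subseteq V\times V$, a function $A:V\times V\to\{0,1\}$, a confidence score $s(v,u)\in[0,1]$ for each pair in $T_0$, and a threshold $\rho\in[0,1]$; its edge set is $E_\rho=\{(v,u)\in T_0: A(v,u)=1 \text{ and } s(v,u)\ge\rho\}$. The set $\mathcal{C}$ of semantic classes is the set of equivalence classes of the reflexive-symmetric-transitive closure of $E_\rho$, so $\mathcal{C}$ is a partition of $V$. Write $\mathrm{cl}(v)\in\mathcal{C}$ for the class containing $v$. Strategies. $\mathcal{X}=\Delta(V)=\{x\in\mathbb{R}_{\ge 0}^{V}:\sum_{v\in V}x_v=1\}$ is the probability simplex on $V$ (not to be confused with the disagreement mass $\Delta(x)$ of a strategy $x$, defined below). Metric and envelope. For a score function $g:V\to[0,1]$, $\mathsf{M}_g(x)=\sum_{v\in V}x_v g(v)$. For $m:V\to[0,1]$, $\mathrm{Env}(m)(v)=\max\{m(u): u\in V,\ \mathrm{cl}(u)=\mathrm{cl}(v)\}$. Harm quantities. The maps $\hat h:\mathcal{C}\to\{0,1\}$ and $h^\star:V\to\{0,1\}$ are arbitrary; harm-purity of classes is not assumed. The true (latent) harmful exposure is $\mathsf{H}^\star(x)=\sum_{v\in V}x_v h^\star(v)$, and the disagreement mass is $\Delta(x)=\sum_{v\in V}x_v\,|h^\star(v)-\hat h(\mathrm{cl}(v))|$. Certification. A metric $\mathsf{M}_g$ is $(\gamma,\beta)$-certifying with respect to latent harm if $\mathsf{H}^\star(x)\le\gamma\,\mathsf{M}_g(x)+\beta$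 for all $x\in\mathcal{X}$. *)

theory Defs
  imports "HOL-Analysis.Analysis"
begin

record 'v audit_protocol =
  candidate_pairs :: "('v \<times> 'v) set"
  audit_outcome :: "'v \<times> 'v \<Rightarrow> nat"
  confidence :: "'v \<times> 'v \<Rightarrow> real"
  threshold :: real

definition is_audit_protocol :: "'v set \<Rightarrow> 'v audit_protocol \<Rightarrow> bool" where
  "is_audit_protocol V P \<longleftrightarrow>
     candidate_pairs P \<subseteq> V \<times> V \<and>
     audit_outcome P \<in> V \<times> V \<rightarrow> {0, 1} \<and>
     confidence P \<in> candidate_pairs P \<rightarrow> {0..1} \<and>
     threshold P \<in> {0..1}"

definition edges :: "'v audit_protocol \<Rightarrow> ('v \<times> 'v) set" where
  "edges P = {e \<in> candidate_pairs P. audit_outcome P e = 1 \<and> confidence P e \<ge> threshold P}"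

text \<open>The library closure \<open>equivclp\<close> is reflexive on the whole type, hence the
  restriction to \<open>V\<close>.\<close>

definition sem_equiv :: "'v set \<Rightarrow> 'v audit_protocol \<Rightarrow> ('v \<times> 'v) set" where
  "sem_equiv V P = {(v, u) \<in> V \<times> V. equivclp (\<lambda>a b. (a, b) \<in> edges P) v u}"

definition sem_classes :: "'v set \<Rightarrow> 'v audit_protocol \<Rightarrow> 'v set set" where
  "sem_classes V P = V // sem_equiv V P"

definition cl :: "'v set \<Rightarrow> 'v audit_protocol \<Rightarrow> 'v \<Rightarrow> 'v set" where
  "cl V P v = sem_equiv V P `` {v}"

definition strategies :: "'v set \<Rightarrow> ('v \<Rightarrow> real) set" where
  "strategies V = {x \<in> V \<rightarrow>\<^sub>E {0..}. (\<Sum>v\<in>V. x v) = 1}"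

definition score_metric :: "'v set \<Rightarrow> ('v \<Rightarrow> real) \<Rightarrow> ('v \<Rightarrow> real) \<Rightarrow> real" where
  "score_metric V g x = (\<Sum>v\<in>V. x v * g v)"

definition env :: "'v set \<Rightarrow> 'v audit_protocol \<Rightarrow> ('v \<Rightarrow> real) \<Rightarrow> 'v \<Rightarrow> real" where
  "env V P m v = Max (m ` {u \<in> V. cl V P u = cl V P v})"

definition true_harm :: "'v set \<Rightarrow> ('v \<Rightarrow> real) \<Rightarrow> ('v \<Rightarrow> real) \<Rightarrow> real" where
  "true_harm V hstar x = (\<Sum>v\<in>V. x v * hstar v)"

definition disagreement ::
  "'v set \<Rightarrow> 'v audit_protocol \<Rightarrow> ('v set \<Rightarrow> real) \<Rightarrow> ('v \<Rightarrow> real) \<Rightarrow> ('v \<Rightarrow> real) \<Rightarrow> real" where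
  "disagreement V P hhat hstar x = (\<Sum>v\<in>V. x v * \<bar>hstar v - hhat (cl V P v)\<bar>)"

definition certifying ::
  "'v set \<Rightarrow> ('v \<Rightarrow> real) \<Rightarrow> (('v \<Rightarrow> real) \<Rightarrow> real) \<Rightarrow> real \<Rightarrow> real \<Rightarrow> bool" where
  "certifying V hstar M \<gamma> \<beta> \<longleftrightarrow> (\<forall>x \<in> strategies V. true_harm V hstar x \<le> \<gamma> * M x + \<beta>)"

text \<open>Meaningful only if some class is labelled harmful; otherwise \<open>Min\<close> is applied to the
  empty set.\<close>

definition alpha_hat ::
  "'v set \<Rightarrow> 'v audit_protocol \<Rightarrow> ('v set \<Rightarrow> real) \<Rightarrow> ('v \<Rightarrow> real) \<Rightarrow> real" where
  "alpha_hat V P hhat m =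
     Min ((\<lambda>c. Max (m ` {u \<in> V. cl V P u = c})) ` {c \<in> sem_classes V P. hhat c = 1})"

end

theory Submission
  imports Defs
begin

text \<open>On every variant the audited label satisfies \<open>\<alpha> * hhat \<le> Env(m)\<close>: a harmful class has
  envelope at least \<open>\<alpha>\<close>, a harmless one has nonnegative envelope. Averaging
  \<open>hstar \<le> hhat + \<bar>hstar - hhat\<bar>\<close> over a strategy gives the bound.\<close>

lemma finite_sem_classes: "finite V \<Longrightarrow> finite (sem_classes V P)"
  by (auto simp: sem_classes_def sem_equiv_def quotient_def)

lemma cl_in_sem_classes: "v \<in> V \<Longrightarrow> cl V P v \<in> sem_classes V P"
  by (simp add: cl_def sem_classes_def quotientI)

text \<open>\<open>v\<close> lies in its own class, so \<open>m v\<close> is among the values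
  maximised; this later makes the envelope nonnegative.\<close>

lemma le_env: "finite V \<Longrightarrow> v \<in> V \<Longrightarrow> m v \<le> env V P m v"
  by (simp add: env_def)

text \<open>The envelope at \<open>v\<close> is the maximum of \<open>m\<close> over
  \<open>cl V P v\<close>; once that class is labelled 1, this is one of the finitely many values
  whose minimum is \<open>alpha_hat\<close>.\<close>

lemma alpha_hat_le_env:
  assumes "finite V" "v \<in> V" "hhat (cl V P v) = 1"
  shows "alpha_hat V P hhat m \<le> env V P m v"
  unfolding alpha_hat_def env_def
  using assms by (intro Min_le) (auto simp: finite_sem_classes cl_in_sem_classes)

lemma label_le_env:
  assumes "finite V" "v \<in> V" "0 \<le> m v" "hhat (cl V P v) \<in> {0, 1}" "alpha_hat V P hhat m > 0"
  shows "hhat (cl V P v) \<le> 1 / alpha_hat V P hhat m * env V P m v"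
proof (cases "hhat (cl V P v) = 1")
  case True
  then show ?thesis
    using alpha_hat_le_env[OF assms(1,2), of hhat P m] assms(5) by (simp add: field_simps)
next
  case False
  \<comment> \<open>The label is 0 here, and 0 \<le> \<open>m v\<close> \<le>
    \<open>env V P m v\<close> makes the right-hand side nonnegative.\<close>
  then show ?thesis
    using assms le_env[OF assms(1,2), of m P] by simp
qed

text \<open>The envelope matters only through a pointwise bound on the label, so the averaging is
  done for any score \<open>g\<close> and factor \<gamma>: weight the triangle inequality by
  \<open>x v\<close> \<ge> 0 and sum over \<open>V\<close>.\<close>

lemma true_harm_le:
  assumes "x \<in> strategies V" "\<And>v. v \<in> V \<Longrightarrow> hhat (cl V P v) \<le> \<gamma> * g v"
  shows "true_harm V hstar x \<le> \<gamma> * score_metric V g x + disagreement V P hhat hstar x"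
proof -
  have "x v * hstar v \<le> \<gamma> * (x v * g v) + x v * \<bar>hstar v - hhat (cl V P v)\<bar>" if "v \<in> V" for v
  proof -
    have "0 \<le> x v"
      using assms(1) that by (auto simp: strategies_def)
    moreover have "hstar v \<le> \<gamma> * g v + \<bar>hstar v - hhat (cl V P v)\<bar>"
      using assms(2)[OF that] by linarith
    ultimately have "x v * hstar v \<le> x v * (\<gamma> * g v + \<bar>hstar v - hhat (cl V P v)\<bar>)"
      by (rule mult_left_mono[rotated])
    then show ?thesis
      by (simp add: algebra_simps)
  qed
  then have "true_harm V hstar x
      \<le> (\<Sum>v\<in>V. \<gamma> * (x v * g v) + x v * \<bar>hstar v - hhat (cl V P v)\<bar>)"
    unfolding true_harm_def by (rule sum_mono)
  then show ?thesis
    by (simp add: score_metric_def disagreement_def sum.distrib sum_distrib_left)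
qed

theorem corollary2:
  fixes V :: "'v set"
    and P :: "'v audit_protocol"
    and m :: "'v \<Rightarrow> real"
    and hhat :: "'v set \<Rightarrow> real"
    and hstar :: "'v \<Rightarrow> real"
    and eta :: real
  assumes "finite V"
    and "is_audit_protocol V P"
    and "m \<in> V \<rightarrow> {0..1}"
    and "hhat \<in> sem_classes V P \<rightarrow> {0, 1}"
    and "hstar \<in> V \<rightarrow> {0, 1}"
    and "\<exists>c \<in> sem_classes V P. hhat c = 1"
    and "alpha_hat V P hhat m > 0"
    and "\<forall>x \<in> strategies V. disagreement V P hhat hstar x \<le> eta"
  shows "(\<forall>x \<in> strategies V.
            true_harm V hstar x \<le> 1 / alpha_hat V P hhat m * score_metric V (env V P m) x + eta) \<and>
         certifying V hstar (score_metric V (env V P m)) (1 / alpha_hat V P hhat m) eta"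
proof -
  have "hhat (cl V P v) \<le> 1 / alpha_hat V P hhat m * env V P m v" if "v \<in> V" for v
    \<comment> \<open>\<open>hhat\<close> is known to be 0 or 1 only on
      \<open>sem_classes V P\<close>, hence the membership of \<open>cl V P v\<close>.\<close>
    using assms that cl_in_sem_classes[OF that, of P] by (intro label_le_env) auto
  then have "true_harm V hstar x \<le> 1 / alpha_hat V P hhat m * score_metric V (env V P m) x + eta"
    if "x \<in> strategies V" for x
    using true_harm_le[OF that, of hhat P "1 / alpha_hat V P hhat m" "env V P m" hstar] assms(8) that
    by fastforce
  then show ?thesis
    by (simp add: certifying_def)
qed

end
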